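(* Let $(G,K,\theta)$ be a multiplicity-free triple (with $\theta$ irreducible on $V$, and $v\in V$ a unit vector) and, for $\sigma\in J$, define $\phi^\sigma\in L(G)$ by $\phi^\sigma(g)=\langle w^\sigma,\sigma(g)w^\sigma\rangle_{W_\sigma}$ for all $g\in G$. Then $\phi^\sigma$ is the spherical function associated with $W_\sigma$; that is, $\phi^\sigma$ is spherical and $U_{\phi^\sigma}=S_\sigma W_\sigma$. Moreover, the following orthogonality relations hold: $$\langle\phi^\sigma,\phi^\rho\rangle_{L(G)}=\frac{|G|}{d_\sigma}\delta_{\sigma,\rho}$$ for all $\sigma,\rho\in J$.
   Context: $G$ is a finite group, $K\le G$, $(\theta,V)$ an irreducible unitary $K$-representation of dimension $d_\theta$; $(G,K,\theta)$ is a multiplicity-free triple if $\mathrm{Ind}_K^G\theta$ contains every irreducible $G$-representation at most once. Inner products are conjugate-linear in the second argument. $L(G)$ is the algebra of functions $G\to\mathbb C$ with convolution $[f_1*f_2](g)=\sum_{h}f_1(gh)f_2(h^{-1})$, $\langle f_1,f_2\rangle_{L(G)}=\sum_gf_1(g)\overline{f_2(g)}$ and left translations $[\lambda_G(h)f](g)=f(h^{-1}g)$. Fix $v\in V$, $\|v\|=1$; $\psi\in L(G)$ is $\psi(k)=\frac{d_\theta}{|K|}\langle v,\theta(k)v\rangle$ for $k\in K$, $\psi=0$ off $K$. $\mathcal H(G,K,\psi)=\{f\in L(G):f=\psi*f*\psi\}$. A function $\phi\in\mathcal H(G,K,\psi)$ is spherical if $\phi(1_G)=1$ and for every $f\in\mathcal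 H(G,K,\psi)$ there is $\lambda_{\phi,f}\in\mathbb C$ with $\phi*f=\lambda_{\phi,f}\phi$. For spherical $\phi$, $U_\phi=\mathrm{span}\{\lambda_G(g)\phi:g\in G\}$. $J$ is a complete set of pairwise inequivalent irreducible (unitary) $G$-representations contained in $\mathrm{Ind}_K^G\theta$; for $\sigma\in J$, $W_\sigma$ is its space and $d_\sigma=\dim W_\sigma$. For $\sigma\in J$, $\mathrm{Hom}_K(V,\mathrm{Res}^G_KW_\sigma)$ is one-dimensional and $L_\sigma:V\to W_\sigma$ is an isometric operator spanning it; $w^\sigma=L_\sigma v$. The map $S_\sigma:W_\sigma\to L(G)$ is $[S_\sigma w](g)=\sqrt{d_\sigma/|G|}\,\langle w,\sigma(g)w^\sigma\rangle_{W_\sigma}$. *)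

theory Defs
  imports
    Complex_Main
    "HOL-Library.Function_Algebras"
    "HOL-Algebra.Group"
begin

section \<open>Complex vector spaces\<close>

class complex_vector = ab_group_add +
  fixes scaleC :: "complex \<Rightarrow> 'a \<Rightarrow> 'a"
  assumes scaleC_add_right: "scaleC a (x + y) = scaleC a x + scaleC a y"
    and scaleC_add_left: "scaleC (a + b) x = scaleC a x + scaleC b x"
    and scaleC_scaleC: "scaleC a (scaleC b x) = scaleC (a * b) x"
    and scaleC_one: "scaleC 1 x = x"

global_interpretation complex_vector: vector_space "scaleC :: complex \<Rightarrow> 'a \<Rightarrow> 'a::complex_vector"
  defines csubspace = complex_vector.subspace
    and cspan = complex_vector.span
    and cdim = complex_vector.dim
  by unfold_locales
    (simp_all add: scaleC_add_right scaleC_add_left scaleC_scaleC scaleC_one)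

instantiation complex :: complex_vector
begin

definition scaleC_complex :: "complex \<Rightarrow> complex \<Rightarrow> complex"
  where "scaleC_complex c z = c * z"

instance
  by standard (simp_all add: scaleC_complex_def algebra_simps)

end

instantiation "fun" :: (type, complex_vector) complex_vector
begin

definition scaleC_fun :: "complex \<Rightarrow> ('a \<Rightarrow> 'b) \<Rightarrow> 'a \<Rightarrow> 'b"
  where "scaleC_fun c f = (\<lambda>x. scaleC c (f x))"

instance
  by standard
    (simp_all add: scaleC_fun_def fun_eq_iff scaleC_add_right scaleC_add_left
      scaleC_scaleC scaleC_one)

end

section \<open>Unitary representations\<close>

text \<open>
  A representation consists of a space, which is a linear subspace of an ambient complex
  vector space, of an inner product on it (the ambient type carries none, and different
  representations on the same type may have unrelated inner products), and of an action.
  Only the values of the inner product and of the action on the space are meaningful.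
\<close>

record ('g, 'w) rep =
  rep_space :: "'w set"
  rep_inner :: "'w \<Rightarrow> 'w \<Rightarrow> complex"
  rep_act :: "'g \<Rightarrow> 'w \<Rightarrow> 'w"

definition inner_product_on :: "'w::complex_vector set \<Rightarrow> ('w \<Rightarrow> 'w \<Rightarrow> complex) \<Rightarrow> bool" where
  "inner_product_on W ip \<longleftrightarrow>
     (\<forall>x\<in>W. \<forall>y\<in>W. \<forall>z\<in>W. ip (x + y) z = ip x z + ip y z) \<and>
     (\<forall>c. \<forall>x\<in>W. \<forall>y\<in>W. ip (scaleC c x) y = c * ip x y) \<and>
     (\<forall>x\<in>W. \<forall>y\<in>W. ip y x = cnj (ip x y)) \<and>
     (\<forall>x\<in>W. x \<noteq> 0 \<longrightarrow> Im (ip x x) = 0 \<and> Re (ip x x) > 0)"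

definition linear_from_to ::
    "'v::complex_vector set \<Rightarrow> 'w::complex_vector set \<Rightarrow> ('v \<Rightarrow> 'w) \<Rightarrow> bool" where
  "linear_from_to V W T \<longleftrightarrow>
     (\<forall>x\<in>V. T x \<in> W) \<and>
     (\<forall>x\<in>V. \<forall>y\<in>V. T (x + y) = T x + T y) \<and>
     (\<forall>c. \<forall>x\<in>V. T (scaleC c x) = scaleC c (T x))"

definition unitary_rep :: "('g, 'm) monoid_scheme \<Rightarrow> ('g, 'w::complex_vector) rep \<Rightarrow> bool" where
  "unitary_rep G \<pi> \<longleftrightarrow>
     csubspace (rep_space \<pi>) \<and>
     (\<exists>B. finite B \<and> rep_space \<pi> \<subseteq> cspan B) \<and>
     inner_product_on (rep_space \<pi>) (rep_inner \<pi>) \<and>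
     (\<forall>g\<in>carrier G. linear_from_to (rep_space \<pi>) (rep_space \<pi>) (rep_act \<pi> g)) \<and>
     (\<forall>w\<in>rep_space \<pi>. rep_act \<pi> \<one>\<^bsub>G\<^esub> w = w) \<and>
     (\<forall>g\<in>carrier G. \<forall>h\<in>carrier G. \<forall>w\<in>rep_space \<pi>.
        rep_act \<pi> (g \<otimes>\<^bsub>G\<^esub> h) w = rep_act \<pi> g (rep_act \<pi> h w)) \<and>
     (\<forall>g\<in>carrier G. \<forall>w\<in>rep_space \<pi>. \<forall>w'\<in>rep_space \<pi>.
        rep_inner \<pi> (rep_act \<pi> g w) (rep_act \<pi> g w') = rep_inner \<pi> w w')"

definition invariant_subspace ::
    "('g, 'm) monoid_scheme \<Rightarrow> ('g, 'w::complex_vector) rep \<Rightarrow> 'w set \<Rightarrow> bool" where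
  "invariant_subspace G \<pi> U \<longleftrightarrow>
     csubspace U \<and> U \<subseteq> rep_space \<pi> \<and> (\<forall>g\<in>carrier G. \<forall>u\<in>U. rep_act \<pi> g u \<in> U)"

definition subrep :: "('g, 'w) rep \<Rightarrow> 'w set \<Rightarrow> ('g, 'w) rep" where
  "subrep \<pi> U = \<pi>\<lparr>rep_space := U\<rparr>"

definition irreducible_rep ::
    "('g, 'm) monoid_scheme \<Rightarrow> ('g, 'w::complex_vector) rep \<Rightarrow> bool" where
  "irreducible_rep G \<pi> \<longleftrightarrow>
     unitary_rep G \<pi> \<and> rep_space \<pi> \<noteq> {0} \<and>
     (\<forall>U. invariant_subspace G \<pi> U \<longrightarrow> U = {0} \<or> U = rep_space \<pi>)"

text \<open>
  Intertwining operators are normalised to vanish outside the space they are defined on, so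
  that \<open>Hom_rep\<close> is a linear subspace of the function type that is isomorphic to the usual
  space of intertwiners.  The restriction of a representation of \<open>G\<close> to a subgroup \<open>K\<close> is the
  same record, regarded as a representation of \<open>G\<lparr>carrier := K\<rparr>\<close>.
\<close>

definition Hom_rep ::
    "('g, 'm) monoid_scheme \<Rightarrow> ('g, 'v::complex_vector) rep \<Rightarrow> ('g, 'w::complex_vector) rep
      \<Rightarrow> ('v \<Rightarrow> 'w) set" where
  "Hom_rep G \<pi> \<rho> =
     {T. linear_from_to (rep_space \<pi>) (rep_space \<rho>) T \<and>
         (\<forall>x. x \<notin> rep_space \<pi> \<longrightarrow> T x = 0) \<and>
         (\<forall>g\<in>carrier G. \<forall>x\<in>rep_space \<pi>. T (rep_act \<pi> g x) = rep_act \<rho> g (T x))}"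

definition equivalent_rep ::
    "('g, 'm) monoid_scheme \<Rightarrow> ('g, 'v::complex_vector) rep \<Rightarrow> ('g, 'w::complex_vector) rep
      \<Rightarrow> bool" where
  "equivalent_rep G \<pi> \<rho> \<longleftrightarrow> (\<exists>T\<in>Hom_rep G \<pi> \<rho>. bij_betw T (rep_space \<pi>) (rep_space \<rho>))"

text \<open>\<open>\<pi>\<close> contains the direct sum of \<open>m\<close> copies of \<open>\<sigma>\<close>.\<close>

definition contains_copies ::
    "('g, 'm) monoid_scheme \<Rightarrow> ('g, 'v::complex_vector) rep \<Rightarrow> nat \<Rightarrow>
      ('g, 'w::complex_vector) rep \<Rightarrow> bool" where
  "contains_copies G \<pi> m \<sigma> \<longleftrightarrow>
     (\<exists>U. (\<forall>i<m. invariant_subspace G \<pi> (U i) \<and> equivalent_rep G (subrep \<pi> (U i)) \<sigma>) \<and>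
          (\<forall>u. (\<forall>i<m. u i \<in> U i) \<and> (\<Sum>i<m. u i) = 0 \<longrightarrow> (\<forall>i<m. u i = 0)))"

abbreviation contains_rep ::
    "('g, 'm) monoid_scheme \<Rightarrow> ('g, 'v::complex_vector) rep \<Rightarrow> ('g, 'w::complex_vector) rep
      \<Rightarrow> bool" where
  "contains_rep G \<pi> \<sigma> \<equiv> contains_copies G \<pi> 1 \<sigma>"

text \<open>
  It is enough to let \<open>\<sigma>\<close> range over representations on the ambient type of \<open>\<pi>\<close>: every
  representation contained in \<open>\<pi>\<close>, on whatever type, is equivalent to a subrepresentation
  of \<open>\<pi>\<close>.  The same applies to \<open>complete_irreps\<close> below.
\<close>

definition multiplicity_free ::
    "('g, 'm) monoid_scheme \<Rightarrow> ('g, 'w::complex_vector) rep \<Rightarrow> bool" where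
  "multiplicity_free G \<pi> \<longleftrightarrow>
     (\<forall>(\<sigma> :: ('g, 'w) rep) m. irreducible_rep G \<sigma> \<and> contains_copies G \<pi> m \<sigma> \<longrightarrow> m \<le> 1)"

text \<open>
  The induced representation acts by left translation on the functions \<open>F : G \<rightarrow> V\<close> with
  \<open>F (g k) = \<theta> (k\<^sup>-\<^sup>1) (F g)\<close>.  Functions on the group are total functions vanishing
  outside the carrier.
\<close>

definition induced_rep ::
    "('g, 'm) monoid_scheme \<Rightarrow> 'g set \<Rightarrow> ('g, 'v::complex_vector) rep \<Rightarrow> ('g, 'g \<Rightarrow> 'v) rep" where
  "induced_rep G K \<theta> =
     \<lparr> rep_space = {F. (\<forall>g. g \<notin> carrier G \<longrightarrow> F g = 0) \<and>
                       (\<forall>g\<in>carrier G. F g \<in> rep_space \<theta>) \<and>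
                       (\<forall>g\<in>carrier G. \<forall>k\<in>K. F (g \<otimes>\<^bsub>G\<^esub> k) = rep_act \<theta> (inv\<^bsub>G\<^esub> k) (F g))},
       rep_inner = (\<lambda>F1 F2. (\<Sum>g\<in>carrier G. rep_inner \<theta> (F1 g) (F2 g)) / of_nat (card K)),
       rep_act = (\<lambda>h F g. if g \<in> carrier G then F (inv\<^bsub>G\<^esub> h \<otimes>\<^bsub>G\<^esub> g) else 0) \<rparr>"

definition multiplicity_free_triple ::
    "('g, 'm) monoid_scheme \<Rightarrow> 'g set \<Rightarrow> ('g, 'v::complex_vector) rep \<Rightarrow> bool" where
  "multiplicity_free_triple G K \<theta> \<longleftrightarrow>
     group G \<and> finite (carrier G) \<and> subgroup K G \<and>
     irreducible_rep (G\<lparr>carrier := K\<rparr>) \<theta> \<and>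
     multiplicity_free G (induced_rep G K \<theta>)"

definition complete_irreps ::
    "('g, 'm) monoid_scheme \<Rightarrow> ('g, 'v::complex_vector) rep \<Rightarrow>
      ('g, 'w::complex_vector) rep set \<Rightarrow> bool" where
  "complete_irreps G \<pi> J \<longleftrightarrow>
     (\<forall>\<sigma>\<in>J. irreducible_rep G \<sigma> \<and> contains_rep G \<pi> \<sigma>) \<and>
     (\<forall>\<sigma>\<in>J. \<forall>\<rho>\<in>J. equivalent_rep G \<sigma> \<rho> \<longrightarrow> \<sigma> = \<rho>) \<and>
     (\<forall>\<tau> :: ('g, 'v) rep. irreducible_rep G \<tau> \<and> contains_rep G \<pi> \<tau> \<longrightarrow>
        (\<exists>\<sigma>\<in>J. equivalent_rep G \<tau> \<sigma>))"

definition isometric_on ::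
    "('g, 'v) rep \<Rightarrow> ('g, 'w) rep \<Rightarrow> ('v \<Rightarrow> 'w) \<Rightarrow> bool" where
  "isometric_on \<pi> \<rho> T \<longleftrightarrow>
     (\<forall>x\<in>rep_space \<pi>. \<forall>y\<in>rep_space \<pi>. rep_inner \<rho> (T x) (T y) = rep_inner \<pi> x y)"

section \<open>The group algebra, the Hecke algebra and spherical functions\<close>

definition LG :: "('g, 'm) monoid_scheme \<Rightarrow> ('g \<Rightarrow> complex) set" where
  "LG G = {f. \<forall>g. g \<notin> carrier G \<longrightarrow> f g = 0}"

definition LG_conv ::
    "('g, 'm) monoid_scheme \<Rightarrow> ('g \<Rightarrow> complex) \<Rightarrow> ('g \<Rightarrow> complex) \<Rightarrow> 'g \<Rightarrow> complex" where
  "LG_conv G f1 f2 =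
     (\<lambda>g. if g \<in> carrier G then \<Sum>h\<in>carrier G. f1 (g \<otimes>\<^bsub>G\<^esub> h) * f2 (inv\<^bsub>G\<^esub> h) else 0)"

definition LG_inner ::
    "('g, 'm) monoid_scheme \<Rightarrow> ('g \<Rightarrow> complex) \<Rightarrow> ('g \<Rightarrow> complex) \<Rightarrow> complex" where
  "LG_inner G f1 f2 = (\<Sum>g\<in>carrier G. f1 g * cnj (f2 g))"

definition left_translation ::
    "('g, 'm) monoid_scheme \<Rightarrow> 'g \<Rightarrow> ('g \<Rightarrow> complex) \<Rightarrow> 'g \<Rightarrow> complex" where
  "left_translation G h f = (\<lambda>g. if g \<in> carrier G then f (inv\<^bsub>G\<^esub> h \<otimes>\<^bsub>G\<^esub> g) else 0)"

definition psi_fun :: "'g set \<Rightarrow> ('g, 'v::complex_vector) rep \<Rightarrow> 'v \<Rightarrow> 'g \<Rightarrow> complex" where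
  "psi_fun K \<theta> v =
     (\<lambda>k. if k \<in> K
          then of_nat (cdim (rep_space \<theta>)) / of_nat (card K) * rep_inner \<theta> v (rep_act \<theta> k v)
          else 0)"

definition hecke_algebra ::
    "('g, 'm) monoid_scheme \<Rightarrow> ('g \<Rightarrow> complex) \<Rightarrow> ('g \<Rightarrow> complex) set" where
  "hecke_algebra G \<psi> = {f \<in> LG G. f = LG_conv G (LG_conv G \<psi> f) \<psi>}"

definition spherical ::
    "('g, 'm) monoid_scheme \<Rightarrow> ('g \<Rightarrow> complex) \<Rightarrow> ('g \<Rightarrow> complex) \<Rightarrow> bool" where
  "spherical G \<psi> \<phi> \<longleftrightarrow>
     \<phi> \<in> hecke_algebra G \<psi> \<and> \<phi> \<one>\<^bsub>G\<^esub> = 1 \<and>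
     (\<forall>f\<in>hecke_algebra G \<psi>. \<exists>c. LG_conv G \<phi> f = scaleC c \<phi>)"

definition translates_span ::
    "('g, 'm) monoid_scheme \<Rightarrow> ('g \<Rightarrow> complex) \<Rightarrow> ('g \<Rightarrow> complex) set" where
  "translates_span G \<phi> = cspan ((\<lambda>g. left_translation G g \<phi>) ` carrier G)"

definition S_map ::
    "('g, 'm) monoid_scheme \<Rightarrow> ('g, 'w::complex_vector) rep \<Rightarrow> 'w \<Rightarrow> 'w \<Rightarrow> 'g \<Rightarrow> complex" where
  "S_map G \<sigma> w\<sigma> w =
     (\<lambda>g. if g \<in> carrier G
          then complex_of_real (sqrt (real (cdim (rep_space \<sigma>)) / real (card (carrier G)))) *
               rep_inner \<sigma> w (rep_act \<sigma> g w\<sigma>)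
          else 0)"

definition phi_fun ::
    "('g, 'm) monoid_scheme \<Rightarrow> ('g, 'w) rep \<Rightarrow> 'w \<Rightarrow> 'g \<Rightarrow> complex" where
  "phi_fun G \<sigma> w\<sigma> =
     (\<lambda>g. if g \<in> carrier G then rep_inner \<sigma> w\<sigma> (rep_act \<sigma> g w\<sigma>) else 0)"

end

theory Submission
  imports Defs "HOL-Computational_Algebra.Fundamental_Theorem_Algebra"
begin

text \<open>
  Convolving a matrix coefficient \<open>\<langle>a, \<sigma>(g) b\<rangle>\<close> with \<open>\<psi>\<close> on the left or on the right replaces \<open>a\<close> or
  \<open>b\<close> by its image under \<open>P = \<sigma>(\<psi>)\<close>.  Schur orthogonality for \<open>\<theta>\<close> gives \<open>P w\<^sup>\<sigma> = w\<^sup>\<sigma>\<close>, and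
  \<open>dim Hom\<^sub>K(V, W\<^sub>\<sigma>) = 1\<close> forces the range of \<open>P\<close> to be the line spanned by \<open>w\<^sup>\<sigma>\<close>.  So \<open>\<phi>\<^sup>\<sigma>\<close> is in the
  Hecke algebra, and \<open>\<phi>\<^sup>\<sigma> * f = (\<phi>\<^sup>\<sigma> * (\<psi> * f)) * \<psi>\<close> is the coefficient of \<open>w\<^sup>\<sigma>\<close> and some \<open>P u\<close>, that is,
  a multiple of \<open>\<phi>\<^sup>\<sigma>\<close>.  Up to a nonzero scalar, \<open>S\<^sub>\<sigma>\<close> maps \<open>\<sigma>(h) w\<^sup>\<sigma>\<close> to the translate of \<open>\<phi>\<^sup>\<sigma>\<close> by
  \<open>h\<close>, and by irreducibility the vectors \<open>\<sigma>(h) w\<^sup>\<sigma>\<close> span \<open>W\<^sub>\<sigma>\<close>.  The orthogonality relations are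
  Schur's for \<open>G\<close>.
\<close>

lemma linear_from_to_0:
  assumes "csubspace V" "linear_from_to V W T"
  shows "T 0 = 0"
  using assms complex_vector.subspace_0[OF assms(1)]
  unfolding linear_from_to_def
  by (metis complex_vector.scale_zero_left)

lemma linear_from_to_sum:
  assumes "csubspace V" "linear_from_to V W T" "\<And>i. i \<in> I \<Longrightarrow> f i \<in> V"
  shows "T (\<Sum>i\<in>I. f i) = (\<Sum>i\<in>I. T (f i))"
  using assms(3)
proof (induction I rule: infinite_finite_induct)
  case (insert i I)
  have "(\<Sum>i\<in>I. f i) \<in> V"
    using insert by (intro complex_vector.subspace_sum[OF assms(1)]) auto
  then show ?case
    using insert assms(2) by (simp add: linear_from_to_def)
qed (simp_all add: linear_from_to_0[OF assms(1,2)])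

lemma linear_from_to_in: "linear_from_to V W T \<Longrightarrow> x \<in> V \<Longrightarrow> T x \<in> W"
  and linear_from_to_add: "linear_from_to V W T \<Longrightarrow> x \<in> V \<Longrightarrow> y \<in> V \<Longrightarrow> T (x + y) = T x + T y"
  and linear_from_to_scaleC: "linear_from_to V W T \<Longrightarrow> x \<in> V \<Longrightarrow> T (scaleC c x) = scaleC c (T x)"
  by (simp_all add: linear_from_to_def)

lemma linear_from_to_subspace_image:
  assumes "csubspace V" "linear_from_to V W T" "csubspace U" "U \<subseteq> V"
  shows "csubspace (T ` U)"
proof (rule complex_vector.subspaceI)
  show "0 \<in> T ` U"
    using linear_from_to_0[OF assms(1,2)] complex_vector.subspace_0[OF assms(3)] by force
next
  fix x y assume "x \<in> T ` U" "y \<in> T ` U"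
  then obtain a b where "a \<in> U" "b \<in> U" "x = T a" "y = T b" by auto
  then show "x + y \<in> T ` U"
    using assms complex_vector.subspace_add[OF assms(3)] linear_from_to_add[OF assms(2), of a b]
    by (metis imageI subsetD)
next
  fix c x assume "x \<in> T ` U"
  then obtain a where "a \<in> U" "x = T a" by auto
  then show "scaleC c x \<in> T ` U"
    using assms complex_vector.subspace_scale[OF assms(3)] linear_from_to_scaleC[OF assms(2), of a c]
    by (metis imageI subsetD)
qed

section \<open>Eigenvectors of operators in finite dimension, via the minimal polynomial of a
  vector\<close>

section \<open>Eigenvectors\<close>

text \<open>This is the vector p(T) x. It is written through iterates because \<open>T\<close> is a
  bare function, linear only on a subspace, so operator polynomials are not at hand.\<close>

definition poly_orbit :: "('w \<Rightarrow> 'w) \<Rightarrow> 'w::complex_vector \<Rightarrow> complex poly \<Rightarrow> 'w" where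
  "poly_orbit T x p = (\<Sum>i\<le>degree p. scaleC (coeff p i) ((T ^^ i) x))"

text \<open>Padding with zero coefficients lets polynomials of different degrees be compared over
  one index range.\<close>

lemma poly_orbit_eq:
  assumes "degree p \<le> N"
  shows "poly_orbit T x p = (\<Sum>i\<le>N. scaleC (coeff p i) ((T ^^ i) x))"
  unfolding poly_orbit_def using assms
  by (intro sum.mono_neutral_left) (auto simp: coeff_eq_0)

lemma poly_orbit_add: "poly_orbit T x (p + q) = poly_orbit T x p + poly_orbit T x q"
proof -
  let ?N = "max (degree p) (degree q)"
  have "degree (p + q) \<le> ?N" by (rule degree_add_le_max)
  then show ?thesis
    by (simp add: poly_orbit_eq[of _ ?N] complex_vector.scale_left_distrib sum.distrib)
qed

lemma poly_orbit_smult: "poly_orbit T x (smult c p) = scaleC c (poly_orbit T x p)"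
  by (simp add: poly_orbit_eq[of _ "degree p"] degree_smult_le complex_vector.scale_sum_right)

text \<open>Multiplying by the variable amounts to applying \<open>T\<close>; this later turns the
  factorisation p = (X - c) q into p(T) x = (T - c) q(T) x.\<close>

lemma poly_orbit_pCons_0:
  assumes "csubspace W" "linear_from_to W W T" "x \<in> W"
  shows "poly_orbit T x (pCons 0 p) = T (poly_orbit T x p)"
proof -
  have it: "(T ^^ i) x \<in> W" for i
    by (induction i) (auto simp: assms linear_from_to_in[OF assms(2)])
  have "poly_orbit T x (pCons 0 p) = (\<Sum>i\<le>Suc (degree p). scaleC (coeff (pCons 0 p) i) ((T ^^ i) x))"
    by (intro poly_orbit_eq) (simp add: degree_pCons_le)
  also have "\<dots> = (\<Sum>i\<le>degree p. scaleC (coeff p i) (T ((T ^^ i) x)))"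
    by (subst sum.atMost_Suc_shift) simp
  also have "\<dots> = (\<Sum>i\<le>degree p. T (scaleC (coeff p i) ((T ^^ i) x)))"
    using it by (simp add: linear_from_to_scaleC[OF assms(2)])
  also have "\<dots> = T (poly_orbit T x p)"
    unfolding poly_orbit_def using it assms
    by (subst linear_from_to_sum[OF assms(1,2)]) (auto intro: complex_vector.subspace_scale)
  finally show ?thesis .
qed

lemma poly_orbit_monom: "poly_orbit T x (monom c n) = scaleC c ((T ^^ n) x)"
proof -
  have "poly_orbit T x (monom c n) = (\<Sum>i\<le>n. scaleC (coeff (monom c n) i) ((T ^^ i) x))"
    by (intro poly_orbit_eq degree_monom_le)
  also have "\<dots> = (\<Sum>i\<in>{n}. scaleC (coeff (monom c n) i) ((T ^^ i) x))"
    by (intro sum.mono_neutral_right) auto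
  finally show ?thesis by simp
qed

text \<open>The iterates with exponents 0 to \<open>card B\<close> are one more than the spanning
  vectors, so they satisfy a linear relation, whose coefficients form \<open>p\<close>.\<close>

lemma annihilating_poly_exists:
  fixes x :: "'w::complex_vector"
  assumes "csubspace W" "W \<subseteq> cspan B" "finite B" "linear_from_to W W T" "x \<in> W"
  obtains p where "p \<noteq> 0" "poly_orbit T x p = 0"
proof (cases "inj_on (\<lambda>i. (T ^^ i) x) {..card B}")
  \<comment> \<open>Linear dependence is a property of sets and does not see a repeated iterate. In
    that case X^i - X^j already annihilates \<open>x\<close>.\<close>
  case False
  then obtain i j where ij: "i \<noteq> j" "(T ^^ i) x = (T ^^ j) x"
    by (auto simp: inj_on_def)
  let ?p = "monom 1 i + monom (-1) j :: complex poly"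
  have "coeff ?p i \<noteq> 0" using ij by simp
  then have "?p \<noteq> 0" by (metis coeff_0)
  moreover have "poly_orbit T x ?p = 0"
    using ij by (simp add: poly_orbit_add poly_orbit_monom)
  ultimately show ?thesis by (rule that)
next
  case True
  let ?f = "\<lambda>i. (T ^^ i) x"
  let ?S = "?f ` {..card B}"
  have it: "?f i \<in> W" for i
    by (induction i) (auto simp: assms linear_from_to_in[OF assms(4)])
  have "card ?S = Suc (card B)" using card_image[OF True] by simp
  then have "complex_vector.dependent ?S"
    using complex_vector.independent_span_bound[OF assms(3), of ?S] it assms(2) by force
  then obtain u where u: "\<exists>y\<in>?S. u y \<noteq> 0" "(\<Sum>y\<in>?S. scaleC (u y) y) = 0"
    by (subst (asm) complex_vector.dependent_finite) auto
  define p where "p = Poly (map (\<lambda>i. u (?f i)) [0..<Suc (card B)])"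
  have cp: "coeff p i = (if i \<le> card B then u (?f i) else 0)" for i
    by (auto simp: p_def nth_default_def simp del: upt_Suc)
  have "p \<noteq> 0"
  proof
    assume "p = 0"
    then have "coeff p i = 0" for i by simp
    then show False using u(1) cp by (metis (no_types, lifting) atMost_iff imageE)
  qed
  moreover have "degree p \<le> card B" by (rule degree_le) (simp add: cp)
  then have "poly_orbit T x p = 0"
    using u(2) by (simp add: poly_orbit_eq cp sum.reindex[OF True])
  ultimately show ?thesis by (rule that)
qed

text \<open>Let p be a nonzero polynomial of least degree with p(T) x = 0, c a root of it and p = (X
  - c) q. By minimality q(T) x is nonzero, and it is an eigenvector for c.\<close>

lemma eigenvector_exists:
  fixes W :: "'w::complex_vector set"
  assumes "csubspace W" "W \<subseteq> cspan B" "finite B" "linear_from_to W W T" "W \<noteq> {0}"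
  obtains c x where "x \<in> W" "x \<noteq> 0" "T x = scaleC c x"
proof -
  obtain x where x: "x \<in> W" "x \<noteq> 0"
    using assms(5) complex_vector.subspace_0[OF assms(1)] by auto
  let ?P = "\<lambda>p. p \<noteq> 0 \<and> poly_orbit T x p = 0"
  obtain p0 where "?P p0"
    using annihilating_poly_exists[OF assms(1-4) x(1)] by metis
  then obtain p where p: "?P p" "\<And>q. ?P q \<Longrightarrow> degree p \<le> degree q"
    using ex_has_least_nat[of ?P p0 degree] by blast
  have "degree p \<noteq> 0"
  proof
    assume "degree p = 0"
    then obtain a where a: "p = monom a 0" by (metis degree_eq_zeroE monom_0)
    then have "scaleC a x = 0" "a \<noteq> 0" using p(1) by (auto simp: poly_orbit_monom)
    then show False using x by simp
  qed
  then have "\<not> constant (poly p)" by (simp add: constant_degree)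
  then obtain c where "poly p c = 0" using fundamental_theorem_of_algebra by blast
  then obtain q where q: "p = [:-c, 1:] * q" by (auto simp: poly_eq_0_iff_dvd)
  have "q \<noteq> 0" using q p(1) by auto
  then have "degree q < degree p"
    unfolding q by (subst degree_mult_eq) auto
  then have ne: "poly_orbit T x q \<noteq> 0" using p(2)[of q] \<open>q \<noteq> 0\<close> by auto
  have "p = pCons 0 q + smult (-c) q" by (simp add: q)
  then have "poly_orbit T x p = T (poly_orbit T x q) + scaleC (-c) (poly_orbit T x q)"
    by (simp only: poly_orbit_add poly_orbit_smult poly_orbit_pCons_0[OF assms(1,4) x(1)])
  then have "T (poly_orbit T x q) = scaleC c (poly_orbit T x q)"
    using p(1) by simp
  moreover have "(T ^^ i) x \<in> W" for i
    by (induction i) (auto simp: x linear_from_to_in[OF assms(4)])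
  then have "poly_orbit T x q \<in> W"
    unfolding poly_orbit_def
    by (intro complex_vector.subspace_sum complex_vector.subspace_scale assms(1))
  ultimately show ?thesis using ne that by blast
qed

section \<open>Subspaces with an inner product: orthonormal bases and Parseval's identity\<close>

section \<open>Inner products\<close>

locale inner_space =
  fixes W :: "'w::complex_vector set" and ip :: "'w \<Rightarrow> 'w \<Rightarrow> complex"
  assumes subspace: "csubspace W" and inner: "inner_product_on W ip"
begin

lemmas zero_mem = complex_vector.subspace_0[OF subspace]
  and add_mem = complex_vector.subspace_add[OF subspace]
  and diff_mem = complex_vector.subspace_diff[OF subspace]
  and scaleC_mem = complex_vector.subspace_scale[OF subspace]
  and sum_mem = complex_vector.subspace_sum[OF subspace]

lemma add_left: "x \<in> W \<Longrightarrow> y \<in> W \<Longrightarrow> z \<in> W \<Longrightarrow> ip (x + y) z = ip x z + ip y z"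
  and scale_left: "x \<in> W \<Longrightarrow> y \<in> W \<Longrightarrow> ip (scaleC c x) y = c * ip x y"
  and ip_pos: "x \<in> W \<Longrightarrow> x \<noteq> 0 \<Longrightarrow> Im (ip x x) = 0 \<and> Re (ip x x) > 0"
  using inner unfolding inner_product_on_def by blast+

lemma cnj_ip: "x \<in> W \<Longrightarrow> y \<in> W \<Longrightarrow> cnj (ip x y) = ip y x"
  using inner unfolding inner_product_on_def by metis

lemma linear_left: "y \<in> W \<Longrightarrow> linear_from_to W UNIV (\<lambda>x. ip x y)"
  by (simp add: linear_from_to_def add_left scale_left scaleC_complex_def)

lemma sum_left: "y \<in> W \<Longrightarrow> (\<And>i. i \<in> I \<Longrightarrow> f i \<in> W) \<Longrightarrow> ip (sum f I) y = (\<Sum>i\<in>I. ip (f i) y)"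
  using linear_from_to_sum[OF subspace linear_left] by blast

lemma scale_right: "x \<in> W \<Longrightarrow> y \<in> W \<Longrightarrow> ip x (scaleC c y) = cnj c * ip x y"
  by (metis cnj_ip complex_cnj_mult scaleC_mem scale_left)

lemma sum_right:
  assumes "y \<in> W" "\<And>i. i \<in> I \<Longrightarrow> f i \<in> W"
  shows "ip y (sum f I) = (\<Sum>i\<in>I. ip y (f i))"
proof -
  have "ip y (sum f I) = cnj (ip (sum f I) y)" using assms by (simp add: cnj_ip sum_mem)
  also have "\<dots> = (\<Sum>i\<in>I. cnj (ip (f i) y))" using assms by (simp add: sum_left)
  also have "\<dots> = (\<Sum>i\<in>I. ip y (f i))" using assms by (intro sum.cong) (auto simp: cnj_ip)
  finally show ?thesis .
qed

lemma zero_left: "y \<in> W \<Longrightarrow> ip 0 y = 0"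
  using sum_left[of y "{}"] by simp

definition orthonormal :: "'w set \<Rightarrow> bool" where
  "orthonormal E \<longleftrightarrow> finite E \<and> E \<subseteq> W \<and> (\<forall>x\<in>E. \<forall>y\<in>E. ip x y = (if x = y then 1 else 0))"

lemma orthonormal_coeff:
  assumes "orthonormal E" "e \<in> E"
  shows "ip (\<Sum>x\<in>E. scaleC (u x) x) e = u e"
proof -
  have "ip (\<Sum>x\<in>E. scaleC (u x) x) e = (\<Sum>x\<in>E. u x * (if x = e then 1 else 0))"
    using assms by (subst sum_left) (auto simp: orthonormal_def scaleC_mem subset_iff scale_left)
  also have "\<dots> = u e" using assms by (simp add: orthonormal_def sum.delta' if_distrib cong: if_cong)
  finally show ?thesis .
qed

lemma orthonormal_independent:
  assumes "orthonormal E"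
  shows "complex_vector.independent E"
proof
  assume "complex_vector.dependent E"
  then obtain u e where u: "e \<in> E" "u e \<noteq> 0" "(\<Sum>y\<in>E. scaleC (u y) y) = 0"
    using assms by (subst (asm) complex_vector.dependent_finite) (auto simp: orthonormal_def)
  then have "ip 0 e = u e" using orthonormal_coeff[OF assms u(1), of u] by simp
  moreover have "e \<in> W" using u(1) assms by (auto simp: orthonormal_def)
  ultimately show False using u zero_left by simp
qed

lemma normalize:
  assumes "x \<in> W" "x \<noteq> 0"
  obtains c where "c \<noteq> 0" "ip (scaleC c x) (scaleC c x) = 1"
proof
  let ?r = "Re (ip x x)"
  \<comment> \<open>The factor is real, so the conjugation in the second argument does not affect
    it.\<close>
  let ?c = "complex_of_real (1 / sqrt ?r)"
  have r: "?r > 0" "ip x x = complex_of_real ?r"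
    using ip_pos[OF assms] by (auto simp: complex_eq_iff)
  show "?c \<noteq> 0" using r by simp
  have "ip (scaleC ?c x) (scaleC ?c x) = ?c * ?c * ip x x"
    using assms by (simp add: scale_left scale_right scaleC_mem)
  also have "\<dots> = complex_of_real (1 / sqrt ?r * (1 / sqrt ?r) * ?r)"
    by (subst r(2)) (simp only: of_real_mult)
  also have "1 / sqrt ?r * (1 / sqrt ?r) * ?r = 1"
    using r(1) by (simp add: field_simps)
  finally show "ip (scaleC ?c x) (scaleC ?c x) = 1" by simp
qed

text \<open>Orthonormal sets are independent, so their size is at most \<open>card B\<close> and one
  of greatest size exists. It must be a basis: otherwise the normalised difference between some
  \<open>x\<close> and its projection could be adjoined.\<close>

lemma orthonormal_basis_exists:
  assumes "W \<subseteq> cspan B" "finite B"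
  obtains E where "orthonormal E" "cspan E = W" "card E = cdim W"
    "\<And>x. x \<in> W \<Longrightarrow> x = (\<Sum>e\<in>E. scaleC (ip x e) e)"
proof -
  have bound: "card E \<le> card B" if "orthonormal E" for E
    using complex_vector.independent_span_bound[OF assms(2) orthonormal_independent[OF that]]
      that assms(1) by (auto simp: orthonormal_def)
  have "orthonormal {}" by (simp add: orthonormal_def)
  then obtain E where E: "orthonormal E" "\<And>F. orthonormal F \<Longrightarrow> card F \<le> card E"
    using ex_has_greatest_nat[of orthonormal "{}" card "Suc (card B)"] bound by (meson le_imp_less_Suc)
  have EW: "e \<in> E \<Longrightarrow> e \<in> W" for e using E(1) by (auto simp: orthonormal_def)
  have exp: "x = (\<Sum>e\<in>E. scaleC (ip x e) e)" if x: "x \<in> W" for x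
  proof (rule ccontr)
    let ?y = "x - (\<Sum>e\<in>E. scaleC (ip x e) e)"
    assume "x \<noteq> (\<Sum>e\<in>E. scaleC (ip x e) e)"
    then have y0: "?y \<noteq> 0" by simp
    have s: "(\<Sum>e\<in>E. scaleC (ip x e) e) \<in> W" using EW by (intro sum_mem scaleC_mem)
    then have y: "?y \<in> W" using x by (intro diff_mem)
    have orth: "ip ?y e = 0" if "e \<in> E" for e
      using add_left[OF y s EW[OF that]] orthonormal_coeff[OF E(1) that, of "ip x"] by simp
    obtain c where c: "c \<noteq> 0" "ip (scaleC c ?y) (scaleC c ?y) = 1"
      using normalize[OF y y0] by blast
    let ?z = "scaleC c ?y"
    have z: "?z \<in> W" using y by (rule scaleC_mem)
    have ze: "ip ?z e = 0" if "e \<in> E" for e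
      using scale_left[OF y EW[OF that]] orth[OF that] by simp
    have ez: "ip e ?z = 0" if "e \<in> E" for e
      using cnj_ip[OF z EW[OF that]] ze[OF that] by simp
    \<comment> \<open>A member of \<open>E\<close> would be orthogonal to itself by
      \<open>ze\<close>, but \<open>?z\<close> has norm 1.\<close>
    have "?z \<notin> E" using c(2) ze by force
    moreover have "orthonormal (insert ?z E)"
      using E(1) z c(2) ze ez \<open>?z \<notin> E\<close> by (auto simp: orthonormal_def)
    ultimately show False
      using E(2)[of "insert ?z E"] E(1) by (simp add: orthonormal_def)
  qed
  have "cspan E = W"
  proof
    show "cspan E \<subseteq> W" using EW subspace by (intro complex_vector.span_minimal) auto
    show "W \<subseteq> cspan E"
    proof
      fix x assume "x \<in> W"
      have "(\<Sum>e\<in>E. scaleC (ip x e) e) \<in> cspan E"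
        by (intro complex_vector.span_sum complex_vector.span_scale complex_vector.span_base)
      then show "x \<in> cspan E" using exp[OF \<open>x \<in> W\<close>] by simp
    qed
  qed
  moreover have "card E = cdim W"
    using complex_vector.dim_eq_card[of E W] orthonormal_independent[OF E(1)] calculation
    by (metis complex_vector.span_span)
  ultimately show ?thesis using that E(1) exp by blast
qed

lemma parseval:
  assumes "orthonormal E" "\<And>x. x \<in> W \<Longrightarrow> x = (\<Sum>e\<in>E. scaleC (ip x e) e)" "x \<in> W" "y \<in> W"
  shows "(\<Sum>e\<in>E. ip x e * ip e y) = ip x y"
proof -
  have EW: "e \<in> E \<Longrightarrow> e \<in> W" for e using assms(1) by (auto simp: orthonormal_def)
  have "ip x y = ip (\<Sum>e\<in>E. scaleC (ip x e) e) y" using assms(2)[OF assms(3)] by simp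
  also have "\<dots> = (\<Sum>e\<in>E. ip x e * ip e y)"
    using EW assms(4) by (subst sum_left) (auto simp: scaleC_mem scale_left)
  finally show ?thesis by simp
qed

end

section \<open>Unitary representations, averaged operators and Schur's lemma for two
  representations\<close>

section \<open>Schur orthogonality\<close>

locale unitary_representation = group G
  for G :: "('g, 'm) monoid_scheme" (structure) and \<pi> :: "('g, 'w::complex_vector) rep" +
  assumes finite_carrier: "finite (carrier G)" and unitary: "unitary_rep G \<pi>"
begin

sublocale inner_space "rep_space \<pi>" "rep_inner \<pi>"
  using unitary by unfold_locales (auto simp: unitary_rep_def)

lemma act_linear: "g \<in> carrier G \<Longrightarrow> linear_from_to (rep_space \<pi>) (rep_space \<pi>) (rep_act \<pi> g)"
  and act_one: "w \<in> rep_space \<pi> \<Longrightarrow> rep_act \<pi> \<one> w = w"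
  and act_mult: "g \<in> carrier G \<Longrightarrow> h \<in> carrier G \<Longrightarrow> w \<in> rep_space \<pi> \<Longrightarrow>
    rep_act \<pi> (g \<otimes> h) w = rep_act \<pi> g (rep_act \<pi> h w)"
  and ip_act: "g \<in> carrier G \<Longrightarrow> w \<in> rep_space \<pi> \<Longrightarrow> w' \<in> rep_space \<pi> \<Longrightarrow>
    rep_inner \<pi> (rep_act \<pi> g w) (rep_act \<pi> g w') = rep_inner \<pi> w w'"
  using unitary unfolding unitary_rep_def by blast+

lemma finite_spanning: obtains B where "finite B" "rep_space \<pi> \<subseteq> cspan B"
  using unitary unfolding unitary_rep_def by blast

lemma act_mem: "g \<in> carrier G \<Longrightarrow> w \<in> rep_space \<pi> \<Longrightarrow> rep_act \<pi> g w \<in> rep_space \<pi>"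
  using act_linear linear_from_to_in by blast

lemma act_add: "g \<in> carrier G \<Longrightarrow> x \<in> rep_space \<pi> \<Longrightarrow> y \<in> rep_space \<pi> \<Longrightarrow>
    rep_act \<pi> g (x + y) = rep_act \<pi> g x + rep_act \<pi> g y"
  and act_scaleC: "g \<in> carrier G \<Longrightarrow> x \<in> rep_space \<pi> \<Longrightarrow>
    rep_act \<pi> g (scaleC c x) = scaleC c (rep_act \<pi> g x)"
  by (rule linear_from_to_add[OF act_linear] linear_from_to_scaleC[OF act_linear]; assumption)+

lemma act_sum:
  assumes "g \<in> carrier G" "\<And>i. i \<in> I \<Longrightarrow> f i \<in> rep_space \<pi>"
  shows "rep_act \<pi> g (sum f I) = (\<Sum>i\<in>I. rep_act \<pi> g (f i))"
  using linear_from_to_sum[OF subspace act_linear[OF assms(1)] assms(2)] .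

text \<open>By unitarity the adjoint of the action of \<open>g\<close> is the action of its
  inverse.\<close>

lemma ip_act_inv:
  assumes "g \<in> carrier G" "x \<in> rep_space \<pi>" "y \<in> rep_space \<pi>"
  shows "rep_inner \<pi> (rep_act \<pi> (inv g) x) y = rep_inner \<pi> x (rep_act \<pi> g y)"
proof -
  have "rep_act \<pi> g (rep_act \<pi> (inv g) x) = x"
    using assms act_mult[of g "inv g" x] by (simp add: act_one)
  then show ?thesis
    using ip_act[OF assms(1) act_mem[of "inv g" x] assms(3)] assms by simp
qed

lemma ip_act_inv_mult:
  assumes "g \<in> carrier G" "h \<in> carrier G" "x \<in> rep_space \<pi>" "y \<in> rep_space \<pi>"
  shows "rep_inner \<pi> (rep_act \<pi> h x) (rep_act \<pi> g y) = rep_inner \<pi> x (rep_act \<pi> (inv h \<otimes> g) y)"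
  using assms ip_act_inv[of "inv h" x "rep_act \<pi> g y"] by (simp add: act_mult act_mem)

text \<open>Left translation permutes the group; every change of summation variable below rests on
  this.\<close>

lemma sum_carrier_mult:
  assumes "h \<in> carrier G"
  shows "(\<Sum>g\<in>carrier G. F (h \<otimes> g)) = (\<Sum>g\<in>carrier G. F g)"
  by (rule sum.reindex_bij_witness[of _ "\<lambda>g. inv h \<otimes> g" "\<lambda>g. h \<otimes> g"])
    (use assms in \<open>auto simp: m_assoc[symmetric]\<close>)

lemma card_carrier_pos: "card (carrier G) > 0"
  using finite_carrier one_closed card_gt_0_iff by blast

text \<open>Makes the Schur theory of this section applicable to the subgroup K.\<close>

lemma unitary_representation_restrict:
  assumes "subgroup K G"
  shows "unitary_representation (G\<lparr>carrier := K\<rparr>) \<pi>"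
proof -
  interpret K: group "G\<lparr>carrier := K\<rparr>"
    using assms by (rule subgroup.subgroup_is_group) (rule is_group)
  have KG: "K \<subseteq> carrier G" using assms by (rule subgroup.subset)
  have "unitary_rep (G\<lparr>carrier := K\<rparr>) \<pi>"
    using unitary KG unfolding unitary_rep_def by (simp add: subset_iff)
  then show ?thesis
    using KG finite_carrier finite_subset by unfold_locales auto
qed

end

text \<open>With A z = <z, a> b, this is the sum over g of rho(g) A pi(g)^-1 applied to
  \<open>x\<close>: unitarity moves pi(g)^-1 onto \<open>a\<close>. The sum is not divided by the
  order of the group.\<close>

definition rank_one_average ::
    "('g, 'm) monoid_scheme \<Rightarrow> ('g, 'v::complex_vector) rep \<Rightarrow> ('g, 'w::complex_vector) rep
      \<Rightarrow> 'v \<Rightarrow> 'w \<Rightarrow> 'v \<Rightarrow> 'w" where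
  "rank_one_average G \<pi> \<rho> a b x =
     (\<Sum>g\<in>carrier G. scaleC (rep_inner \<pi> x (rep_act \<pi> g a)) (rep_act \<rho> g b))"

locale unitary_representation_pair =
  P: unitary_representation G \<pi> + R: unitary_representation G \<rho>
  for G :: "('g, 'm) monoid_scheme" (structure)
    and \<pi> :: "('g, 'v::complex_vector) rep" and \<rho> :: "('g, 'w::complex_vector) rep"
begin

lemma rank_one_average_linear:
  assumes "a \<in> rep_space \<pi>" "b \<in> rep_space \<rho>"
  shows "linear_from_to (rep_space \<pi>) (rep_space \<rho>) (rank_one_average G \<pi> \<rho> a b)"
  unfolding linear_from_to_def rank_one_average_def using assms
  by (auto intro!: R.sum_mem R.scaleC_mem
      simp: R.act_mem P.act_mem P.add_left P.scale_left complex_vector.scale_left_distrib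
      sum.distrib complex_vector.scale_sum_right)

text \<open>Substitute h g for g: unitarity removes h from the inner product, and on the other side
  h factors out of the action.\<close>

lemma rank_one_average_equivariant:
  assumes "a \<in> rep_space \<pi>" "b \<in> rep_space \<rho>" "h \<in> carrier G" "x \<in> rep_space \<pi>"
  shows "rank_one_average G \<pi> \<rho> a b (rep_act \<pi> h x) = rep_act \<rho> h (rank_one_average G \<pi> \<rho> a b x)"
proof -
  have "rank_one_average G \<pi> \<rho> a b (rep_act \<pi> h x) =
      (\<Sum>g\<in>carrier G. scaleC (rep_inner \<pi> (rep_act \<pi> h x) (rep_act \<pi> (h \<otimes> g) a)) (rep_act \<rho> (h \<otimes> g) b))"
    unfolding rank_one_average_def
    by (rule P.sum_carrier_mult[OF assms(3), symmetric])
  also have "\<dots> = (\<Sum>g\<in>carrier G. rep_act \<rho> h (scaleC (rep_inner \<pi> x (rep_act \<pi> g a)) (rep_act \<rho> g b)))"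
    using assms
    by (intro sum.cong) (simp_all add: P.act_mult R.act_mult P.ip_act P.act_mem R.act_mem R.act_scaleC)
  also have "\<dots> = rep_act \<rho> h (rank_one_average G \<pi> \<rho> a b x)"
    unfolding rank_one_average_def using assms
    by (subst R.act_sum) (simp_all add: R.act_mem R.scaleC_mem)
  finally show ?thesis .
qed

text \<open>The matrix entries of the averaged operator are exactly the sums in the orthogonality
  relations, so any knowledge of that operator translates into orthogonality.\<close>

lemma ip_rank_one_average:
  assumes "b \<in> rep_space \<rho>" "y \<in> rep_space \<rho>"
  shows "rep_inner \<rho> (rank_one_average G \<pi> \<rho> a b x) y =
    (\<Sum>g\<in>carrier G. rep_inner \<pi> x (rep_act \<pi> g a) * cnj (rep_inner \<rho> y (rep_act \<rho> g b)))"
  unfolding rank_one_average_def using assms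
  by (subst R.sum_left)
    (auto intro!: sum.cong simp: R.act_mem R.scaleC_mem R.scale_left R.cnj_ip)

text \<open>Kernel and image of an intertwiner are invariant. If it were nonzero, irreducibility
  would make the kernel trivial and the image everything, giving an equivalence.\<close>

lemma schur_inequivalent:
  assumes irr: "irreducible_rep G \<pi>" "irreducible_rep G \<rho>" and ineq: "\<not> equivalent_rep G \<pi> \<rho>"
    and lin: "linear_from_to (rep_space \<pi>) (rep_space \<rho>) T"
    and equi: "\<And>g x. g \<in> carrier G \<Longrightarrow> x \<in> rep_space \<pi> \<Longrightarrow> T (rep_act \<pi> g x) = rep_act \<rho> g (T x)"
    and x: "x \<in> rep_space \<pi>"
  shows "T x = 0"
proof (rule ccontr)
  assume Tx: "T x \<noteq> 0"
  let ?K = "{y \<in> rep_space \<pi>. T y = 0}"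
  have T0: "T 0 = 0" using linear_from_to_0[OF P.subspace lin] .
  have act0: "rep_act \<rho> g 0 = 0" if "g \<in> carrier G" for g
    using linear_from_to_0[OF R.subspace R.act_linear[OF that]] .
  have "csubspace ?K"
    using T0 by (intro complex_vector.subspaceI)
      (auto simp: P.zero_mem P.add_mem P.scaleC_mem linear_from_to_add[OF lin] linear_from_to_scaleC[OF lin])
  then have "invariant_subspace G \<pi> ?K"
    unfolding invariant_subspace_def by (auto simp: P.act_mem equi act0)
  moreover have "?K \<noteq> rep_space \<pi>" using Tx x by auto
  ultimately have ker: "?K = {0}" using irr(1) unfolding irreducible_rep_def by blast
  have "csubspace (T ` rep_space \<pi>)"
    using linear_from_to_subspace_image[OF P.subspace lin P.subspace] by simp
  then have "invariant_subspace G \<rho> (T ` rep_space \<pi>)"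
    unfolding invariant_subspace_def using linear_from_to_in[OF lin]
    by (auto simp: equi[symmetric] P.act_mem)
  moreover have "T ` rep_space \<pi> \<noteq> {0}" using Tx x by blast
  ultimately have img: "T ` rep_space \<pi> = rep_space \<rho>"
    using irr(2) unfolding irreducible_rep_def by blast
  have "inj_on T (rep_space \<pi>)"
  proof (rule inj_onI)
    fix y z assume yz: "y \<in> rep_space \<pi>" "z \<in> rep_space \<pi>" "T y = T z"
    then have "T (y - z) = 0"
      using linear_from_to_add[OF lin P.diff_mem[OF yz(1,2)] yz(2)] by simp
    then show "y = z" using ker P.diff_mem[OF yz(1,2)] by (simp add: set_eq_iff) (metis eq_iff_diff_eq_0)
  qed
  then have bij: "bij_betw T (rep_space \<pi>) (rep_space \<rho>)" using img by (simp add: bij_betw_def)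
  \<comment> \<open>Members of \<open>Hom_rep\<close> have to vanish outside the space, so
    \<open>T\<close> is cut off there.\<close>
  let ?T = "\<lambda>y. if y \<in> rep_space \<pi> then T y else 0"
  have "?T \<in> Hom_rep G \<pi> \<rho>"
    using lin equi unfolding Hom_rep_def linear_from_to_def
    by (auto simp: P.add_mem P.scaleC_mem P.act_mem)
  moreover have "bij_betw ?T (rep_space \<pi>) (rep_space \<rho>)"
    using bij by (subst bij_betw_cong[where g = T]) auto
  ultimately show False using ineq unfolding equivalent_rep_def by blast
qed

lemma schur_orthogonality_inequivalent:
  assumes "irreducible_rep G \<pi>" "irreducible_rep G \<rho>" "\<not> equivalent_rep G \<pi> \<rho>"
    and "a \<in> rep_space \<pi>" "x \<in> rep_space \<pi>" "b \<in> rep_space \<rho>" "y \<in> rep_space \<rho>"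
  shows "(\<Sum>g\<in>carrier G. rep_inner \<pi> x (rep_act \<pi> g a) * cnj (rep_inner \<rho> y (rep_act \<rho> g b))) = 0"
proof -
  have "rank_one_average G \<pi> \<rho> a b x = 0"
    using assms
    by (intro schur_inequivalent rank_one_average_linear rank_one_average_equivariant) auto
  then show ?thesis
    using ip_rank_one_average[of b y a x] assms R.zero_left by simp
qed

end

section \<open>Schur's lemma and orthogonality for a single representation\<close>

context unitary_representation
begin

text \<open>The eigenspace of one eigenvalue is invariant and nonzero, hence the whole
  space.\<close>

lemma schur_scalar:
  assumes irr: "irreducible_rep G \<pi>"
    and lin: "linear_from_to (rep_space \<pi>) (rep_space \<pi>) T"
    and equi: "\<And>g x. g \<in> carrier G \<Longrightarrow> x \<in> rep_space \<pi> \<Longrightarrow> T (rep_act \<pi> g x) = rep_act \<pi> g (T x)"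
  obtains c where "\<And>x. x \<in> rep_space \<pi> \<Longrightarrow> T x = scaleC c x"
proof -
  obtain B where "finite B" "rep_space \<pi> \<subseteq> cspan B" by (rule finite_spanning)
  moreover have "rep_space \<pi> \<noteq> {0}" using irr by (simp add: irreducible_rep_def)
  ultimately obtain c x where x: "x \<in> rep_space \<pi>" "x \<noteq> 0" "T x = scaleC c x"
    using eigenvector_exists[OF subspace _ _ lin] by metis
  let ?U = "{y \<in> rep_space \<pi>. T y = scaleC c y}"
  have "csubspace ?U"
    using linear_from_to_0[OF subspace lin]
    by (intro complex_vector.subspaceI)
      (auto simp: zero_mem add_mem scaleC_mem linear_from_to_add[OF lin] linear_from_to_scaleC[OF lin]
        complex_vector.scale_right_distrib mult.commute)
  then have "invariant_subspace G \<pi> ?U"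
    unfolding invariant_subspace_def by (auto simp: act_mem equi act_scaleC)
  moreover have "?U \<noteq> {0}" using x by blast
  ultimately have "?U = rep_space \<pi>" using irr unfolding irreducible_rep_def by blast
  then show ?thesis using that[of c] by blast
qed

lemma dim_pos:
  assumes "irreducible_rep G \<pi>"
  shows "cdim (rep_space \<pi>) > 0"
proof -
  obtain B where B: "finite B" "rep_space \<pi> \<subseteq> cspan B" by (rule finite_spanning)
  obtain E where E: "orthonormal E" "cspan E = rep_space \<pi>" "card E = cdim (rep_space \<pi>)"
    using orthonormal_basis_exists[OF B(2,1)] by metis
  have "E \<noteq> {}" using E(2) assms by (auto simp: irreducible_rep_def)
  then show ?thesis using E(1) unfolding E(3)[symmetric] orthonormal_def card_gt_0_iff by blast
qed

text \<open>The scalar is found by computing the trace over an orthonormal basis.\<close>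

lemma rank_one_average_scalar:
  assumes irr: "irreducible_rep G \<pi>"
    and mem: "a \<in> rep_space \<pi>" "b \<in> rep_space \<pi>" "x \<in> rep_space \<pi>"
  shows "rank_one_average G \<pi> \<pi> a b x =
    scaleC (of_nat (card (carrier G)) / of_nat (cdim (rep_space \<pi>)) * rep_inner \<pi> b a) x"
proof -
  interpret unitary_representation_pair G \<pi> \<pi> ..
  let ?T = "rank_one_average G \<pi> \<pi> a b"
  obtain c where c: "\<And>x. x \<in> rep_space \<pi> \<Longrightarrow> ?T x = scaleC c x"
    using schur_scalar[OF irr rank_one_average_linear[OF mem(1,2)]]
      rank_one_average_equivariant[OF mem(1,2)] by metis
  obtain B where B: "finite B" "rep_space \<pi> \<subseteq> cspan B" by (rule finite_spanning)
  obtain E where E: "orthonormal E" "card E = cdim (rep_space \<pi>)"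
      "\<And>x. x \<in> rep_space \<pi> \<Longrightarrow> x = (\<Sum>e\<in>E. scaleC (rep_inner \<pi> x e) e)"
    using orthonormal_basis_exists[OF B(2,1)] by metis
  have EW: "e \<in> E \<Longrightarrow> e \<in> rep_space \<pi>" for e using E(1) by (auto simp: orthonormal_def)
  have "of_nat (cdim (rep_space \<pi>)) * c = (\<Sum>e\<in>E. c * rep_inner \<pi> e e)"
    using E(1) by (simp add: orthonormal_def E(2))
  also have "\<dots> = (\<Sum>e\<in>E. rep_inner \<pi> (?T e) e)"
    using EW by (intro sum.cong) (auto simp: c scale_left)
  also have "\<dots> = (\<Sum>e\<in>E. \<Sum>g\<in>carrier G. rep_inner \<pi> (rep_act \<pi> g b) e * rep_inner \<pi> e (rep_act \<pi> g a))"
    using EW mem by (intro sum.cong) (auto intro!: sum.cong simp: ip_rank_one_average cnj_ip act_mem)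
  also have "\<dots> = (\<Sum>g\<in>carrier G. \<Sum>e\<in>E. rep_inner \<pi> (rep_act \<pi> g b) e * rep_inner \<pi> e (rep_act \<pi> g a))"
    by (rule sum.swap)
  \<comment> \<open>Parseval collapses the sum over the basis, and unitarity then removes
    \<open>g\<close>.\<close>
  also have "\<dots> = (\<Sum>g\<in>carrier G. rep_inner \<pi> b a)"
    using mem by (intro sum.cong) (auto simp: parseval[OF E(1,3)] act_mem ip_act)
  finally have "c = of_nat (card (carrier G)) / of_nat (cdim (rep_space \<pi>)) * rep_inner \<pi> b a"
    using dim_pos[OF irr] by (simp add: field_simps)
  then show ?thesis using c mem by simp
qed

text \<open>The averaged operator is a known scalar; pairing its value at \<open>x\<close> with
  \<open>y\<close> gives the relation.\<close>

lemma schur_orthogonality: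
  assumes irr: "irreducible_rep G \<pi>"
    and mem: "a \<in> rep_space \<pi>" "b \<in> rep_space \<pi>" "x \<in> rep_space \<pi>" "y \<in> rep_space \<pi>"
  shows "(\<Sum>g\<in>carrier G. rep_inner \<pi> x (rep_act \<pi> g a) * cnj (rep_inner \<pi> y (rep_act \<pi> g b))) =
    of_nat (card (carrier G)) / of_nat (cdim (rep_space \<pi>)) * rep_inner \<pi> b a * rep_inner \<pi> x y"
proof -
  interpret unitary_representation_pair G \<pi> \<pi> ..
  show ?thesis
    using ip_rank_one_average[OF mem(2,4), of a x] rank_one_average_scalar[OF irr mem(1-3)]
    by (simp add: scale_left mem)
qed

end

section \<open>How convolution acts on the two vectors of a matrix coefficient\<close>

section \<open>Matrix coefficients and convolution\<close>

text \<open>Generalises \<open>phi_fun\<close> to two vectors, since left and right convolution move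
  them independently.\<close>

definition matrix_coeff ::
    "('g, 'm) monoid_scheme \<Rightarrow> ('g, 'w) rep \<Rightarrow> 'w \<Rightarrow> 'w \<Rightarrow> 'g \<Rightarrow> complex" where
  "matrix_coeff G \<pi> a b = (\<lambda>g. if g \<in> carrier G then rep_inner \<pi> a (rep_act \<pi> g b) else 0)"

text \<open>The operator pi(f) of the representation extended to the group algebra.\<close>

definition algebra_act ::
    "('g, 'm) monoid_scheme \<Rightarrow> ('g, 'w::complex_vector) rep \<Rightarrow> ('g \<Rightarrow> complex) \<Rightarrow> 'w \<Rightarrow> 'w" where
  "algebra_act G \<pi> f x = (\<Sum>h\<in>carrier G. scaleC (f h) (rep_act \<pi> h x))"

context unitary_representation
begin

lemma algebra_act_mem: "x \<in> rep_space \<pi> \<Longrightarrow> algebra_act G \<pi> f x \<in> rep_space \<pi>"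
  unfolding algebra_act_def by (intro sum_mem scaleC_mem act_mem)

lemma conv_matrix_coeff:
  assumes "a \<in> rep_space \<pi>" "b \<in> rep_space \<pi>"
  shows "LG_conv G f (matrix_coeff G \<pi> a b) = matrix_coeff G \<pi> (algebra_act G \<pi> f a) b"
proof (intro ext)
  fix g
  show "LG_conv G f (matrix_coeff G \<pi> a b) g = matrix_coeff G \<pi> (algebra_act G \<pi> f a) b g"
  proof (cases "g \<in> carrier G")
    case True
    \<comment> \<open>The inverse of h is written as (g h)^-1 g, so that the summand depends on h
      only through g h and the sum can be shifted.\<close>
    have "LG_conv G f (matrix_coeff G \<pi> a b) g =
        (\<Sum>h\<in>carrier G. f (g \<otimes> h) * rep_inner \<pi> a (rep_act \<pi> (inv (g \<otimes> h) \<otimes> g) b))"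
      using True by (auto simp: LG_conv_def matrix_coeff_def inv_mult_group m_assoc intro!: sum.cong)
    also have "\<dots> = (\<Sum>h\<in>carrier G. f h * rep_inner \<pi> a (rep_act \<pi> (inv h \<otimes> g) b))"
      by (rule sum_carrier_mult[OF True])
    also have "\<dots> = (\<Sum>h\<in>carrier G. rep_inner \<pi> (scaleC (f h) (rep_act \<pi> h a)) (rep_act \<pi> g b))"
      using assms True by (intro sum.cong) (auto simp: scale_left act_mem ip_act_inv_mult)
    also have "\<dots> = rep_inner \<pi> (algebra_act G \<pi> f a) (rep_act \<pi> g b)"
      unfolding algebra_act_def using assms True by (subst sum_left) (auto simp: act_mem scaleC_mem)
    finally show ?thesis using True by (simp add: matrix_coeff_def)
  qed (simp add: LG_conv_def matrix_coeff_def)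
qed

text \<open>The inverse comes from the convolution formula, the conjugate from conjugate-linearity
  in the second argument: \<open>b\<close> is moved by the operator of the adjoint of
  \<open>f\<close>.\<close>

lemma matrix_coeff_conv:
  assumes "a \<in> rep_space \<pi>" "b \<in> rep_space \<pi>"
  shows "LG_conv G (matrix_coeff G \<pi> a b) f =
    matrix_coeff G \<pi> a (algebra_act G \<pi> (\<lambda>h. cnj (f (inv h))) b)"
proof (intro ext)
  fix g
  show "LG_conv G (matrix_coeff G \<pi> a b) f g =
      matrix_coeff G \<pi> a (algebra_act G \<pi> (\<lambda>h. cnj (f (inv h))) b) g"
  proof (cases "g \<in> carrier G")
    case True
    have "rep_inner \<pi> a (rep_act \<pi> g (algebra_act G \<pi> (\<lambda>h. cnj (f (inv h))) b)) =
       rep_inner \<pi> a (\<Sum>h\<in>carrier G. scaleC (cnj (f (inv h))) (rep_act \<pi> (g \<otimes> h) b))"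
      unfolding algebra_act_def using assms True
      by (subst act_sum) (simp_all add: act_mem scaleC_mem act_scaleC act_mult)
    also have "\<dots> = (\<Sum>h\<in>carrier G. f (inv h) * rep_inner \<pi> a (rep_act \<pi> (g \<otimes> h) b))"
      using assms True by (subst sum_right) (simp_all add: act_mem scaleC_mem scale_right)
    finally show ?thesis
      using True by (simp add: LG_conv_def matrix_coeff_def mult.commute)
  qed (simp add: LG_conv_def matrix_coeff_def)
qed

lemma LG_conv_assoc: "LG_conv G (LG_conv G f1 f2) f3 = LG_conv G f1 (LG_conv G f2 f3)"
proof (intro ext)
  fix g
  show "LG_conv G (LG_conv G f1 f2) f3 g = LG_conv G f1 (LG_conv G f2 f3) g"
  proof (cases "g \<in> carrier G")
    case True
    \<comment> \<open>Here the inverse of k is written as (h k)^-1 h, so that the inner sum can be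
      shifted by h.\<close>
    have "LG_conv G (LG_conv G f1 f2) f3 g =
        (\<Sum>h\<in>carrier G. \<Sum>k\<in>carrier G. f1 (g \<otimes> (h \<otimes> k)) * f2 (inv (h \<otimes> k) \<otimes> h) * f3 (inv h))"
      using True by (auto simp: LG_conv_def sum_distrib_right inv_mult_group m_assoc intro!: sum.cong)
    also have "\<dots> = (\<Sum>h\<in>carrier G. \<Sum>k\<in>carrier G. f1 (g \<otimes> k) * f2 (inv k \<otimes> h) * f3 (inv h))"
      by (rule sum.cong[OF refl]) (rule sum_carrier_mult)
    also have "\<dots> = (\<Sum>k\<in>carrier G. \<Sum>h\<in>carrier G. f1 (g \<otimes> k) * f2 (inv k \<otimes> h) * f3 (inv h))"
      by (rule sum.swap)
    also have "\<dots> = LG_conv G f1 (LG_conv G f2 f3) g"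
      using True by (auto simp: LG_conv_def sum_distrib_left mult.assoc intro!: sum.cong)
    finally show ?thesis .
  qed (simp add: LG_conv_def)
qed

end

section \<open>The vector of L, the operator of psi, and the spherical function of one
  representation\<close>

section \<open>Spherical matrix coefficients\<close>

text \<open>The situation for one member of J. One-dimensionality of the space of K-intertwiners is
  expressed by \<open>Hom\<close>.\<close>

locale spherical_vector = S: unitary_representation G \<sigma>
  for G :: "('g, 'm) monoid_scheme" (structure)
    and \<sigma> :: "('g, 'w::complex_vector) rep" +
  fixes K :: "'g set" and \<theta> :: "('g, 'v::complex_vector) rep" and L :: "'v \<Rightarrow> 'w" and v :: 'v
  assumes irreducible: "irreducible_rep G \<sigma>"
    and subgroup: "subgroup K G"
    and irreducible_\<theta>: "irreducible_rep (G\<lparr>carrier := K\<rparr>) \<theta>"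
    and isometric: "isometric_on \<theta> \<sigma> L"
    and Hom: "Hom_rep (G\<lparr>carrier := K\<rparr>) \<theta> \<sigma> = cspan {L}"
    and v: "v \<in> rep_space \<theta>" "rep_inner \<theta> v v = 1"
begin

abbreviation "\<psi> \<equiv> psi_fun K \<theta> v"
abbreviation "w \<equiv> L v"

text \<open>The rewrites state facts about the restriction with K and the operations of G, so that
  they combine with facts about G. The inverse is translated separately by \<open>inv_K\<close>, for
  elements of K.\<close>

sublocale SK: unitary_representation "G\<lparr>carrier := K\<rparr>" \<sigma>
  rewrites "carrier (G\<lparr>carrier := K\<rparr>) = K" and "(\<otimes>\<^bsub>G\<lparr>carrier := K\<rparr>\<^esub>) = (\<otimes>)"
    and "\<one>\<^bsub>G\<lparr>carrier := K\<rparr>\<^esub> = \<one>"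
  using S.unitary_representation_restrict[OF subgroup] by simp_all

sublocale T: unitary_representation "G\<lparr>carrier := K\<rparr>" \<theta>
  using SK.is_group SK.finite_carrier irreducible_\<theta>
  by unfold_locales (simp_all add: irreducible_rep_def)

sublocale TS: unitary_representation_pair "G\<lparr>carrier := K\<rparr>" \<theta> \<sigma> ..

lemma K_subset: "k \<in> K \<Longrightarrow> k \<in> carrier G"
  using subgroup.subset[OF subgroup] by blast

lemma inv_K: "k \<in> K \<Longrightarrow> inv\<^bsub>G\<lparr>carrier := K\<rparr>\<^esub> k = inv k"
  using S.m_inv_consistent[OF subgroup] by simp

lemma L_Hom: "L \<in> Hom_rep (G\<lparr>carrier := K\<rparr>) \<theta> \<sigma>"
  using Hom complex_vector.span_base by auto

lemma L_linear: "linear_from_to (rep_space \<theta>) (rep_space \<sigma>) L"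
  and L_act: "k \<in> K \<Longrightarrow> x \<in> rep_space \<theta> \<Longrightarrow> L (rep_act \<theta> k x) = rep_act \<sigma> k (L x)"
  using L_Hom by (auto simp: Hom_rep_def)

lemma w_mem: "w \<in> rep_space \<sigma>"
  using L_linear v(1) by (rule linear_from_to_in)

lemma w_unit: "rep_inner \<sigma> w w = 1"
  using isometric v by (simp add: isometric_on_def)

text \<open>psi is supported on K and is there a multiple of a coefficient of theta. The varying
  vector \<open>x\<close> takes the second slot of the rank one operator, and the average is
  evaluated at \<open>v\<close>.\<close>

lemma algebra_act_psi:
  "algebra_act G \<sigma> \<psi> x =
     scaleC (of_nat (cdim (rep_space \<theta>)) / of_nat (card K)) (rank_one_average (G\<lparr>carrier := K\<rparr>) \<theta> \<sigma> v x v)"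
proof -
  have "algebra_act G \<sigma> \<psi> x = (\<Sum>k\<in>K. scaleC (\<psi> k) (rep_act \<sigma> k x))"
    unfolding algebra_act_def using K_subset S.finite_carrier
    by (intro sum.mono_neutral_right) (auto simp: psi_fun_def)
  also have "\<dots> = scaleC (of_nat (cdim (rep_space \<theta>)) / of_nat (card K))
      (rank_one_average (G\<lparr>carrier := K\<rparr>) \<theta> \<sigma> v x v)"
    by (simp add: rank_one_average_def complex_vector.scale_sum_right psi_fun_def)
  finally show ?thesis .
qed

text \<open>Since L intertwines, it can be pulled out of the average. What remains is an average for
  theta alone, which Schur evaluates at \<open>v\<close> as |K| / d_theta times \<open>v\<close>;
  the normalisation of psi cancels this factor.\<close>

lemma algebra_act_psi_w: "algebra_act G \<sigma> \<psi> w = w"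
proof -
  have "rank_one_average (G\<lparr>carrier := K\<rparr>) \<theta> \<sigma> v w v = L (rank_one_average (G\<lparr>carrier := K\<rparr>) \<theta> \<theta> v v v)"
    unfolding rank_one_average_def
    using v(1) T.act_mem
    by (subst linear_from_to_sum[OF T.subspace L_linear])
      (simp_all add: T.scaleC_mem linear_from_to_scaleC[OF L_linear] L_act)
  also have "\<dots> = scaleC (of_nat (card K) / of_nat (cdim (rep_space \<theta>))) w"
    using v by (simp add: T.rank_one_average_scalar[OF irreducible_\<theta>] linear_from_to_scaleC[OF L_linear])
  finally show ?thesis
    using T.dim_pos[OF irreducible_\<theta>] SK.card_carrier_pos by (simp add: algebra_act_psi)
qed

text \<open>One-dimensionality of \<open>Hom\<close> enters here: as a function of its last argument, the averaged
  rank one operator is a \<open>K\<close>-intertwiner, hence a multiple of \<open>L\<close>.\<close>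

lemma algebra_act_psi_range:
  assumes "x \<in> rep_space \<sigma>"
  obtains c where "algebra_act G \<sigma> \<psi> x = scaleC c w"
proof -
  let ?A = "rank_one_average (G\<lparr>carrier := K\<rparr>) \<theta> \<sigma> v x"
  let ?T = "\<lambda>y. if y \<in> rep_space \<theta> then ?A y else 0"
  have "?T \<in> Hom_rep (G\<lparr>carrier := K\<rparr>) \<theta> \<sigma>"
    using TS.rank_one_average_linear[OF v(1) assms] TS.rank_one_average_equivariant[OF v(1) assms]
    unfolding Hom_rep_def linear_from_to_def
    by (auto simp: T.add_mem T.scaleC_mem T.act_mem)
  then obtain c where "?T = scaleC c L"
    unfolding Hom complex_vector.span_singleton by auto
  then have "?T v = scaleC c L v" by (rule fun_cong)
  then have "?A v = scaleC c w" using v(1) by (simp add: scaleC_fun_def)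
  then have "algebra_act G \<sigma> \<psi> x = scaleC (of_nat (cdim (rep_space \<theta>)) / of_nat (card K) * c) w"
    by (simp add: algebra_act_psi)
  then show ?thesis by (rule that)
qed

text \<open>psi is its own adjoint, so left and right convolution by psi involve the same operator.
  On K this is unitarity; off K both sides vanish.\<close>

lemma psi_hermitian:
  assumes "g \<in> carrier G"
  shows "cnj (\<psi> (inv g)) = \<psi> g"
proof (cases "g \<in> K")
  case True
  have "cnj (rep_inner \<theta> v (rep_act \<theta> (inv g) v)) = rep_inner \<theta> v (rep_act \<theta> g v)"
    using T.ip_act_inv[of g v v] True v(1) T.act_mem[of "inv g" v]
      subgroup.m_inv_closed[OF subgroup True] T.cnj_ip[of v "rep_act \<theta> (inv g) v"]
    by (simp add: inv_K)
  then show ?thesis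
    using True subgroup.m_inv_closed[OF subgroup True] by (simp add: psi_fun_def)
next
  case False
  then have "inv g \<notin> K" using subgroup.m_inv_closed[OF subgroup, of "inv g"] assms by auto
  then show ?thesis using False by (simp add: psi_fun_def)
qed

lemma matrix_coeff_conv_psi:
  assumes "a \<in> rep_space \<sigma>" "b \<in> rep_space \<sigma>"
  shows "LG_conv G (matrix_coeff G \<sigma> a b) \<psi> = matrix_coeff G \<sigma> a (algebra_act G \<sigma> \<psi> b)"
  using S.matrix_coeff_conv[OF assms, of \<psi>] by (simp add: algebra_act_def psi_hermitian cong: sum.cong)

lemma phi_eq: "phi_fun G \<sigma> w = matrix_coeff G \<sigma> w w"
  by (simp add: phi_fun_def matrix_coeff_def)

lemma spherical_phi: "spherical G \<psi> (phi_fun G \<sigma> w)"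
  unfolding spherical_def
proof (intro conjI ballI)
  show "phi_fun G \<sigma> w \<in> hecke_algebra G \<psi>"
    unfolding hecke_algebra_def phi_eq using w_mem
    by (simp add: S.conv_matrix_coeff matrix_coeff_conv_psi algebra_act_psi_w)
      (simp add: LG_def matrix_coeff_def)
  show "phi_fun G \<sigma> w \<one> = 1"
    using w_unit S.act_one[OF w_mem] by (simp add: phi_fun_def)
next
  fix f assume "f \<in> hecke_algebra G \<psi>"
  then have f: "f = LG_conv G (LG_conv G \<psi> f) \<psi>" by (simp add: hecke_algebra_def)
  \<comment> \<open>Chosen so that phi * (psi * f) is the matrix coefficient of \<open>w\<close> and
    \<open>u\<close>.\<close>
  define u where "u = algebra_act G \<sigma> (\<lambda>h. cnj (LG_conv G \<psi> f (inv h))) w"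
  have u: "u \<in> rep_space \<sigma>" unfolding u_def by (rule S.algebra_act_mem[OF w_mem])
  obtain c where c: "algebra_act G \<sigma> \<psi> u = scaleC c w" using algebra_act_psi_range[OF u] .
  \<comment> \<open>Expanding f as (psi * f) * psi and reassociating leaves a final convolution by
    psi, which projects \<open>u\<close> onto the line of \<open>w\<close>.\<close>
  have "LG_conv G (phi_fun G \<sigma> w) f = LG_conv G (LG_conv G (matrix_coeff G \<sigma> w w) (LG_conv G \<psi> f)) \<psi>"
    by (subst f) (simp only: S.LG_conv_assoc phi_eq)
  also have "\<dots> = matrix_coeff G \<sigma> w (scaleC c w)"
    using w_mem u by (simp add: S.matrix_coeff_conv[of _ _ "LG_conv G \<psi> f"] matrix_coeff_conv_psi c flip: u_def)
  \<comment> \<open>The scalar leaves the second argument of the inner product, hence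
    conjugated.\<close>
  also have "\<dots> = scaleC (cnj c) (phi_fun G \<sigma> w)"
    using w_mem by (auto simp: fun_eq_iff phi_eq matrix_coeff_def scaleC_fun_def scaleC_complex_def
        S.act_scaleC S.scale_right S.act_mem)
  finally show "\<exists>c. LG_conv G (phi_fun G \<sigma> w) f = scaleC c (phi_fun G \<sigma> w)" by blast
qed

lemma S_map_linear: "linear_from_to (rep_space \<sigma>) UNIV (S_map G \<sigma> w)"
  unfolding linear_from_to_def S_map_def using w_mem
  by (auto simp: fun_eq_iff scaleC_fun_def scaleC_complex_def S.add_left S.scale_left S.act_mem
      algebra_simps)

lemma translates_span_phi: "translates_span G (phi_fun G \<sigma> w) = S_map G \<sigma> w ` rep_space \<sigma>"
proof -
  define r where "r = complex_of_real (sqrt (real (cdim (rep_space \<sigma>)) / real (card (carrier G))))"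
  have r: "r \<noteq> 0" using S.dim_pos[OF irreducible] S.card_carrier_pos by (simp add: r_def)
  \<comment> \<open>Up to the normalising constant of \<open>S_map\<close>, the orbit of
    \<open>w\<close> corresponds to the translates of phi.\<close>
  have tr: "S_map G \<sigma> w (rep_act \<sigma> h w) = scaleC r (left_translation G h (phi_fun G \<sigma> w))"
    if "h \<in> carrier G" for h
    using that w_mem
    by (auto simp: fun_eq_iff S_map_def left_translation_def phi_fun_def scaleC_fun_def
        scaleC_complex_def r_def S.ip_act_inv_mult)
  let ?N = "translates_span G (phi_fun G \<sigma> w)"
  have N: "csubspace ?N" unfolding translates_span_def by (rule complex_vector.subspace_span)
  \<comment> \<open>Requiring the condition for the whole orbit of \<open>x\<close> makes this
    subspace invariant at once.\<close>
  let ?U = "{x \<in> rep_space \<sigma>. \<forall>h\<in>carrier G. S_map G \<sigma> w (rep_act \<sigma> h x) \<in> ?N}"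
  have "csubspace ?U"
    using linear_from_to_0[OF S.subspace S_map_linear] linear_from_to_0[OF S.subspace S.act_linear]
    by (intro complex_vector.subspaceI)
      (auto simp: S.zero_mem S.add_mem S.scaleC_mem S.act_add S.act_scaleC S.act_mem
        linear_from_to_add[OF S_map_linear] linear_from_to_scaleC[OF S_map_linear]
        complex_vector.subspace_0[OF N]
        intro: complex_vector.subspace_add[OF N] complex_vector.subspace_scale[OF N])
  then have "invariant_subspace G \<sigma> ?U"
    unfolding invariant_subspace_def by (auto simp: S.act_mem simp flip: S.act_mult)
  moreover have "w \<in> ?U"
    using w_mem unfolding translates_span_def
    by (auto simp: tr intro!: complex_vector.span_scale[OF complex_vector.span_base])
  moreover have "w \<noteq> 0" using w_unit S.zero_left[OF S.zero_mem] by auto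
  ultimately have U: "?U = rep_space \<sigma>" using irreducible unfolding irreducible_rep_def by blast
  show ?thesis
  proof
    show "?N \<subseteq> S_map G \<sigma> w ` rep_space \<sigma>"
      unfolding translates_span_def
    proof (rule complex_vector.span_minimal)
      show img: "csubspace (S_map G \<sigma> w ` rep_space \<sigma>)"
        by (rule linear_from_to_subspace_image[OF S.subspace S_map_linear S.subspace]) simp
      have "left_translation G h (phi_fun G \<sigma> w) = S_map G \<sigma> w (scaleC (1 / r) (rep_act \<sigma> h w))"
        if "h \<in> carrier G" for h
        using that r w_mem by (simp add: linear_from_to_scaleC[OF S_map_linear] S.act_mem tr)
      then show "(\<lambda>g. left_translation G g (phi_fun G \<sigma> w)) ` carrier G \<subseteq> S_map G \<sigma> w ` rep_space \<sigma>"
        using w_mem by (auto simp: S.scaleC_mem S.act_mem)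
    qed
    show "S_map G \<sigma> w ` rep_space \<sigma> \<subseteq> ?N"
    proof
      fix F assume "F \<in> S_map G \<sigma> w ` rep_space \<sigma>"
      then obtain x where x: "x \<in> rep_space \<sigma>" "F = S_map G \<sigma> w x" by blast
      \<comment> \<open>The case h = 1 of the orbit condition recovers \<open>x\<close>
        itself.\<close>
      then have "S_map G \<sigma> w (rep_act \<sigma> \<one> x) \<in> ?N" using U by blast
      then show "F \<in> ?N" using x by (simp add: S.act_one)
    qed
  qed
qed

end

section \<open>Orthogonality of the spherical functions and assembly of the result\<close>

lemma LG_inner_phi:
  "LG_inner G (phi_fun G \<sigma> a) (phi_fun G \<rho> b) =
     (\<Sum>g\<in>carrier G. rep_inner \<sigma> a (rep_act \<sigma> g a) * cnj (rep_inner \<rho> b (rep_act \<rho> g b)))"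
  by (simp add: LG_inner_def phi_fun_def)

theorem theorem4p18:
  fixes G :: "('g, 'm) monoid_scheme"
    and K :: "'g set"
    and \<theta> :: "('g, 'v::complex_vector) rep"
    and v :: 'v
    and J :: "('g, 'w::complex_vector) rep set"
    and L :: "('g, 'w) rep \<Rightarrow> 'v \<Rightarrow> 'w"
  assumes "multiplicity_free_triple G K \<theta>"
    and "v \<in> rep_space \<theta>" and "rep_inner \<theta> v v = 1"
    and "complete_irreps G (induced_rep G K \<theta>) J"
    and "\<And>\<sigma>. \<sigma> \<in> J \<Longrightarrow> isometric_on \<theta> \<sigma> (L \<sigma>)"
    and "\<And>\<sigma>. \<sigma> \<in> J \<Longrightarrow> Hom_rep (G\<lparr>carrier := K\<rparr>) \<theta> \<sigma> = cspan {L \<sigma>}"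
  shows "(\<forall>\<sigma>\<in>J. spherical G (psi_fun K \<theta> v) (phi_fun G \<sigma> (L \<sigma> v)) \<and>
                 translates_span G (phi_fun G \<sigma> (L \<sigma> v)) = S_map G \<sigma> (L \<sigma> v) ` rep_space \<sigma>) \<and>
         (\<forall>\<sigma>\<in>J. \<forall>\<rho>\<in>J.
            LG_inner G (phi_fun G \<sigma> (L \<sigma> v)) (phi_fun G \<rho> (L \<rho> v)) =
              (if \<sigma> = \<rho> then of_nat (card (carrier G)) / of_nat (cdim (rep_space \<sigma>)) else 0))"
proof -
  have irr: "irreducible_rep G \<sigma>" if "\<sigma> \<in> J" for \<sigma>
    using assms(4) that unfolding complete_irreps_def by blast
  have rep: "unitary_representation G \<sigma>" if "\<sigma> \<in> J" for \<sigma>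
    using assms(1) irr[OF that]
    by (simp add: unitary_representation_def unitary_representation_axioms_def
        multiplicity_free_triple_def irreducible_rep_def)
  have sph: "spherical_vector G \<sigma> K \<theta> (L \<sigma>) v" if "\<sigma> \<in> J" for \<sigma>
    using rep[OF that] irr[OF that] assms(1-3,5,6) that
    by (simp add: spherical_vector_def spherical_vector_axioms_def multiplicity_free_triple_def)
  show ?thesis
  proof (intro conjI ballI)
    fix \<sigma> assume "\<sigma> \<in> J"
    then interpret spherical_vector G \<sigma> K \<theta> "L \<sigma>" v by (rule sph)
    show "spherical G (psi_fun K \<theta> v) (phi_fun G \<sigma> (L \<sigma> v))" by (rule spherical_phi)
    show "translates_span G (phi_fun G \<sigma> (L \<sigma> v)) = S_map G \<sigma> (L \<sigma> v) ` rep_space \<sigma>"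
      by (rule translates_span_phi)
  next
    fix \<sigma> \<rho> assume J: "\<sigma> \<in> J" "\<rho> \<in> J"
    interpret P: spherical_vector G \<sigma> K \<theta> "L \<sigma>" v using J(1) by (rule sph)
    interpret R: spherical_vector G \<rho> K \<theta> "L \<rho>" v using J(2) by (rule sph)
    interpret unitary_representation_pair G \<sigma> \<rho> ..
    show "LG_inner G (phi_fun G \<sigma> (L \<sigma> v)) (phi_fun G \<rho> (L \<rho> v)) =
        (if \<sigma> = \<rho> then of_nat (card (carrier G)) / of_nat (cdim (rep_space \<sigma>)) else 0)"
    proof (cases "\<sigma> = \<rho>")
      case True
      then show ?thesis
        \<comment> \<open>All four vectors are \<open>L \<sigma> v\<close>, of norm 1, so only the
          factor |G| / d_sigma survives.\<close>
        using P.S.schur_orthogonality[OF irr[OF J(1)] P.w_mem P.w_mem P.w_mem P.w_mem]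
        by (simp add: LG_inner_phi R.w_unit)
    next
      case False
      then have "\<not> equivalent_rep G \<sigma> \<rho>"
        using assms(4) J unfolding complete_irreps_def by blast
      then show ?thesis
        using False schur_orthogonality_inequivalent[OF irr[OF J(1)] irr[OF J(2)]]
          P.w_mem R.w_mem by (simp add: LG_inner_phi)
    qed
  qed
qed

end
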